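(* Let $f:[a,b]\to\mathbb{R}$ and $c\in(a,b)$. If $f$ is Sequential Henstock integrable on $[a,c]$ and on $[c,b]$, then $f$ is Sequential Henstock integrable on $[a,b]$ and $$\int_a^b f=\int_a^c f+\int_c^b f.$$
   Context: For a compact interval $I=[p,q]\subset\mathbb{R}$: a tagged partition $P=\{([x_{i-1},x_i],t_i)\}_{i=1}^k$ of $I$ consists of points $p=x_0<x_1<\dots<x_k=q$ together with tags $t_i\in[x_{i-1},x_i]$. Its Riemann sum for $f$ is $S(f,P)=\sum_{i=1}^k f(t_i)(x_i-x_{i-1})$. A gauge on $I$ is a function $\delta:I\to\mathbb{R}$ with $\delta(x)>0$ for all $x\in I$. $P$ is $\delta(x)$-fine if $x_i-x_{i-1}<\delta(t_i)$ for every $i$. $f$ is Sequential Henstock integrable on $I$ with integral $A=\int_I f=\int_p^q f\in\mathbb{R}$ if there is a sequence of gauges $\{\delta_n\}_{n=1}^\infty$ on $I$ such that, whenever $P_n$ is a $\delta_n(x)$-fine tagged partition of $I$ for each $n$, one has $S(f,P_n)\to A$ as $n\to\infty$. The value of the integral is unique. *)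

theory Defs
  imports Complex_Main
begin

text \<open>
  A tagged partition \<open>{([x\<^sub>i\<^sub>-\<^sub>1, x\<^sub>i], t\<^sub>i)}\<close>, \<open>1 \<le> i \<le> k\<close>, is stored as \<open>k\<close> together with
  \<open>x\<close> (relevant on \<open>{0..k}\<close>) and \<open>t\<close> (relevant on \<open>{1..k}\<close>); other values are junk
  that no definition below looks at.
\<close>

record tagged_part =
  ncells :: nat
  node :: "nat \<Rightarrow> real"
  tag :: "nat \<Rightarrow> real"

definition tagged_partition_of :: "tagged_part \<Rightarrow> real \<Rightarrow> real \<Rightarrow> bool" where
  "tagged_partition_of P p q \<longleftrightarrow>
     node P 0 = p \<and> node P (ncells P) = q \<and>
     (\<forall>i\<in>{1..ncells P}. node P (i - 1) < node P i \<and> tag P i \<in> {node P (i - 1)..node P i})"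

definition riemann_sum :: "(real \<Rightarrow> real) \<Rightarrow> tagged_part \<Rightarrow> real" where
  "riemann_sum f P = (\<Sum>i=1..ncells P. f (tag P i) * (node P i - node P (i - 1)))"

definition gauge_fun_on :: "real \<Rightarrow> real \<Rightarrow> (real \<Rightarrow> real) \<Rightarrow> bool" where
  "gauge_fun_on p q \<delta> \<longleftrightarrow> (\<forall>x\<in>{p..q}. \<delta> x > 0)"

definition fine_part :: "(real \<Rightarrow> real) \<Rightarrow> tagged_part \<Rightarrow> bool" where
  "fine_part \<delta> P \<longleftrightarrow> (\<forall>i\<in>{1..ncells P}. node P i - node P (i - 1) < \<delta> (tag P i))"

definition has_seq_henstock_integral ::
    "(real \<Rightarrow> real) \<Rightarrow> real \<Rightarrow> real \<Rightarrow> real \<Rightarrow> bool" where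
  "has_seq_henstock_integral f p q A \<longleftrightarrow>
     (\<exists>\<delta> :: nat \<Rightarrow> real \<Rightarrow> real.
        (\<forall>n. gauge_fun_on p q (\<delta> n)) \<and>
        (\<forall>P :: nat \<Rightarrow> tagged_part.
           (\<forall>n. tagged_partition_of (P n) p q \<and> fine_part (\<delta> n) (P n)) \<longrightarrow>
           (\<lambda>n. riemann_sum f (P n)) \<longlonglongrightarrow> A))"

definition seq_henstock_integrable :: "(real \<Rightarrow> real) \<Rightarrow> real \<Rightarrow> real \<Rightarrow> bool" where
  "seq_henstock_integrable f p q \<longleftrightarrow> (\<exists>A. has_seq_henstock_integral f p q A)"

text \<open>Meaningful only when \<open>f\<close> is integrable and \<open>p \<le> q\<close>, in which case the value is unique.\<close>

definition seq_henstock_integral :: "(real \<Rightarrow> real) \<Rightarrow> real \<Rightarrow> real \<Rightarrow> real" where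
  "seq_henstock_integral f p q = (THE A. has_seq_henstock_integral f p q A)"

end

theory Submission
  imports Defs
begin

text \<open>
  Let \<open>\<delta>\<^sub>1\<close> and \<open>\<delta>\<^sub>2\<close> be gauges witnessing integrability on \<open>[a,c]\<close> and \<open>[c,b]\<close>. Shrink them to one
  gauge \<open>\<delta>\<close> on \<open>[a,b]\<close> with \<open>\<delta> x \<le> \<bar>x - c\<bar>\<close> for all \<open>x \<noteq> c\<close>. A cell of a \<open>\<delta>\<close>-fine partition whose
  tag is not \<open>c\<close> is then too short to reach \<open>c\<close>, so every cell containing \<open>c\<close> is tagged by \<open>c\<close>.
  Cutting such a cell at \<open>c\<close> and keeping the tag \<open>c\<close> for both halves leaves the Riemann sum
  unchanged, so every \<open>\<delta>\<close>-fine sum on \<open>[a,b]\<close> is a \<open>\<delta>\<^sub>1\<close>-fine sum on \<open>[a,c]\<close> plus a \<open>\<delta>\<^sub>2\<close>-fine sum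
  on \<open>[c,b]\<close> (lemma \<open>fine_sum_split\<close>). Applied at every index of a sequence of gauges, this gives
  convergence to the sum of the two integrals.

  The equation between integral values also needs uniqueness of the integral. This is
  Cousin's lemma (\<open>fine_sum_exists\<close>): every gauge admits a fine partition, so partitions fine for
  two sequences of gauges simultaneously have sums converging to both candidate values.

  Only the value of a Riemann sum matters for the integral, so the argument is carried out with
  the inductive relation \<open>fine_sum\<close>, in which partitions grow one cell at a time and no
  reindexing of nodes is required.
\<close>

section \<open>Values of fine Riemann sums\<close>

inductive fine_sum :: "(real \<Rightarrow> real) \<Rightarrow> (real \<Rightarrow> real) \<Rightarrow> real \<Rightarrow> real \<Rightarrow> real \<Rightarrow> bool"
  for \<delta> f p where
  empty: "fine_sum \<delta> f p p 0"
| snoc: "fine_sum \<delta> f p u s \<Longrightarrow> u < v \<Longrightarrow> t \<in> {u..v} \<Longrightarrow> v - u < \<delta> t \<Longrightarrow>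
    fine_sum \<delta> f p v (s + f t * (v - u))"

lemma fine_sum_cell:
  assumes "u < v" "t \<in> {u..v}" "v - u < \<delta> t"
  shows "fine_sum \<delta> f u v (f t * (v - u))"
  using fine_sum.snoc[of \<delta> f u u 0 v t, OF fine_sum.empty assms] by simp

lemma fine_sum_imp_partition:
  assumes "fine_sum \<delta> f p q s"
  shows "\<exists>P. tagged_partition_of P p q \<and> fine_part \<delta> P \<and> riemann_sum f P = s"
  using assms
proof induction
  case empty
  have "tagged_partition_of \<lparr>ncells = 0, node = \<lambda>_. p, tag = \<lambda>_. p\<rparr> p p"
    by (simp add: tagged_partition_of_def)
  then show ?case
    by (intro exI[of _ "\<lparr>ncells = 0, node = \<lambda>_. p, tag = \<lambda>_. p\<rparr>"])
       (simp add: fine_part_def riemann_sum_def)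
next
  case (snoc u s v t)
  then obtain P where P: "tagged_partition_of P p u" "fine_part \<delta> P" "riemann_sum f P = s"
    by blast
  let ?k = "ncells P"
  let ?P = "\<lparr>ncells = Suc ?k, node = (node P)(Suc ?k := v), tag = (tag P)(Suc ?k := t)\<rparr>"
  have node_k: "node P ?k = u"
    using P(1) by (simp add: tagged_partition_of_def)
  have "tagged_partition_of ?P p v"
    using P(1) snoc node_k by (auto simp: tagged_partition_of_def le_Suc_eq)
  moreover have "fine_part \<delta> ?P"
    using P(2) snoc node_k by (auto simp: fine_part_def le_Suc_eq)
  moreover have "riemann_sum f ?P = s + f t * (v - u)"
  proof -
    have "(\<Sum>i=1..?k. f (tag ?P i) * (node ?P i - node ?P (i - 1))) = riemann_sum f P"
      unfolding riemann_sum_def by (rule sum.cong) auto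
    then show ?thesis
      using P(3) node_k by (simp add: riemann_sum_def)
  qed
  ultimately show ?case by blast
qed

lemma partition_imp_fine_sum:
  assumes P: "tagged_partition_of P p q" "fine_part \<delta> P"
  shows "fine_sum \<delta> f p q (riemann_sum f P)"
proof -
  have "fine_sum \<delta> f p (node P j) (\<Sum>i=1..j. f (tag P i) * (node P i - node P (i - 1)))"
    if "j \<le> ncells P" for j
    using that
  proof (induction j)
    case 0
    have "node P 0 = p"
      using P(1) by (simp add: tagged_partition_of_def)
    then show ?case
      using fine_sum.empty by simp
  next
    case (Suc j)
    then have "Suc j \<in> {1..ncells P}"
      by simp
    then have "node P j < node P (Suc j)" "tag P (Suc j) \<in> {node P j..node P (Suc j)}"
      "node P (Suc j) - node P j < \<delta> (tag P (Suc j))"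
      using P unfolding tagged_partition_of_def fine_part_def by (metis diff_Suc_1)+
    then show ?case
      using fine_sum.snoc[OF Suc.IH] Suc.prems by simp
  qed
  from this[of "ncells P"] show ?thesis
    using P(1) by (simp add: tagged_partition_of_def riemann_sum_def)
qed

lemma has_seq_henstock_integral_iff_fine_sum:
  "has_seq_henstock_integral f p q A \<longleftrightarrow>
    (\<exists>\<delta>. (\<forall>n. gauge_fun_on p q (\<delta> n)) \<and>
         (\<forall>s. (\<forall>n. fine_sum (\<delta> n) f p q (s n)) \<longrightarrow> s \<longlonglongrightarrow> A))"
proof -
  have "(\<forall>P. (\<forall>n. tagged_partition_of (P n) p q \<and> fine_part (\<delta> n) (P n)) \<longrightarrow>
          (\<lambda>n. riemann_sum f (P n)) \<longlonglongrightarrow> A) \<longleftrightarrow>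
        (\<forall>s. (\<forall>n. fine_sum (\<delta> n) f p q (s n)) \<longrightarrow> s \<longlonglongrightarrow> A)"
    (is "?L \<longleftrightarrow> ?R") for \<delta> :: "nat \<Rightarrow> real \<Rightarrow> real"
  proof
    assume L: ?L
    show ?R
    proof (intro allI impI)
      fix s assume "\<forall>n. fine_sum (\<delta> n) f p q (s n)"
      then have "\<forall>n. \<exists>P. tagged_partition_of P p q \<and> fine_part (\<delta> n) P \<and> riemann_sum f P = s n"
        using fine_sum_imp_partition by blast
      then obtain P where "\<forall>n. tagged_partition_of (P n) p q \<and> fine_part (\<delta> n) (P n) \<and>
          riemann_sum f (P n) = s n"
        by metis
      then show "s \<longlonglongrightarrow> A"
        using L[rule_format, of P] by simp
    qed
  next
    assume ?R
    then show ?L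
      by (simp add: partition_imp_fine_sum)
  qed
  then show ?thesis
    unfolding has_seq_henstock_integral_def by simp
qed

section \<open>Operations on fine sums\<close>

lemma fine_sum_le: "fine_sum \<delta> f p q s \<Longrightarrow> p \<le> q"
  by (induction rule: fine_sum.induct) auto

lemma fine_sum_mono:
  assumes "fine_sum \<delta> f p q s" and "\<And>x. x \<in> {p..q} \<Longrightarrow> \<delta> x \<le> \<delta>' x"
  shows "fine_sum \<delta>' f p q s"
  using assms
proof induction
  case empty
  show ?case by (rule fine_sum.empty)
next
  case (snoc u s v t)
  have "p \<le> u"
    using snoc.hyps(1) by (rule fine_sum_le)
  then have "v - u < \<delta>' t"
    using snoc.hyps snoc.prems[of t] by auto
  moreover have "fine_sum \<delta>' f p u s"
    using snoc.IH snoc.prems snoc.hyps(2) by simp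
  ultimately show ?case
    using snoc.hyps by (intro fine_sum.snoc)
qed

lemma fine_sum_append:
  assumes "fine_sum \<delta> f q r s'" and "fine_sum \<delta> f p q s"
  shows "fine_sum \<delta> f p r (s + s')"
  using assms
proof induction
  case empty
  then show ?case by simp
next
  case (snoc u s' v t)
  then have "fine_sum \<delta> f p v (s + s' + f t * (v - u))"
    by (intro fine_sum.snoc)
  then show ?case by (simp add: add.assoc)
qed

text \<open>
  Cousin's lemma. Being joined by some fine partition is a transitive property of the end points,
  and it holds for all sufficiently short intervals around any point \<open>x\<close>, since \<open>x\<close> itself can serve
  as the tag of the only cell. Bolzano's bisection principle extends such a property to the whole
  interval.
\<close>

lemma fine_sum_exists:
  assumes "p \<le> q" and "gauge_fun_on p q \<delta>"
  shows "\<exists>s. fine_sum \<delta> f p q s"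
  using assms(1)
proof (induction rule: Bolzano)
  case (trans u v w)
  then show ?case
    using fine_sum_append by blast
next
  case (local x)
  have "\<exists>s. fine_sum \<delta> f u v s" if "u \<le> x" "x \<le> v" "v - u < \<delta> x" for u v
  proof (cases "u = v")
    case True
    then show ?thesis
      using fine_sum.empty by blast
  next
    case False
    then show ?thesis
      using that fine_sum_cell[of u v x \<delta> f] by auto
  qed
  then show ?case
    using assms(2) local by (intro exI[of _ "\<delta> x"]) (auto simp: gauge_fun_on_def)
qed

text \<open>
  The hypothesis on \<open>\<delta>\<close> forces the tag \<open>c\<close> on a cell \<open>[u,v]\<close> with \<open>u < c \<le> v\<close>, so that cell can be
  cut at \<open>c\<close> into two fine cells (only one if \<open>c = v\<close>) with the same tag and the same total
  contribution.
\<close>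

lemma fine_sum_split:
  assumes "fine_sum \<delta> f a b s" and "a \<le> c" "c \<le> b"
    and short: "\<And>x. x \<noteq> c \<Longrightarrow> \<delta> x \<le> \<bar>x - c\<bar>"
  shows "\<exists>s\<^sub>1 s\<^sub>2. fine_sum \<delta> f a c s\<^sub>1 \<and> fine_sum \<delta> f c b s\<^sub>2 \<and> s = s\<^sub>1 + s\<^sub>2"
  using assms(1,3)
proof induction
  case empty
  then have "c = a"
    using \<open>a \<le> c\<close> by simp
  then show ?case
    using fine_sum.empty[of \<delta> f a] by force
next
  case (snoc u s v t)
  show ?case
  proof (cases "c \<le> u")
    case True
    then obtain s\<^sub>1 s\<^sub>2 where "fine_sum \<delta> f a c s\<^sub>1" "fine_sum \<delta> f c u s\<^sub>2" "s = s\<^sub>1 + s\<^sub>2"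
      using snoc.IH by blast
    moreover from this(2) have "fine_sum \<delta> f c v (s\<^sub>2 + f t * (v - u))"
      using snoc.hyps by (intro fine_sum.snoc)
    ultimately show ?thesis
      by (metis add.assoc)
  next
    case False
    have "t = c"
    proof (rule ccontr)
      assume "t \<noteq> c"
      then have "v - u < \<bar>t - c\<bar>"
        using short[of t] snoc.hyps(4) by linarith
      then show False
        using snoc.hyps(3) snoc.prems False by auto
    qed
    then have left: "fine_sum \<delta> f a c (s + f c * (c - u))"
      using snoc.hyps snoc.prems False by (intro fine_sum.snoc) auto
    have right: "fine_sum \<delta> f c v (f c * (v - c))"
    proof (cases "c = v")
      case True
      then show ?thesis
        using fine_sum.empty by simp
    next
      case False
      then show ?thesis
        using \<open>t = c\<close> \<open>\<not> c \<le> u\<close> snoc.hyps snoc.prems by (intro fine_sum_cell) auto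
    qed
    have "s + f t * (v - u) = (s + f c * (c - u)) + f c * (v - c)"
      using \<open>t = c\<close> by (simp add: algebra_simps)
    then show ?thesis
      using left right by blast
  qed
qed

section \<open>Uniqueness and additivity of the integral\<close>

lemma has_seq_henstock_integral_unique:
  assumes "p \<le> q" and "has_seq_henstock_integral f p q A" and "has_seq_henstock_integral f p q B"
  shows "A = B"
proof -
  obtain \<delta> where \<delta>: "\<And>n. gauge_fun_on p q (\<delta> n)"
      "\<And>s. (\<And>n. fine_sum (\<delta> n) f p q (s n)) \<Longrightarrow> s \<longlonglongrightarrow> A"
    using assms(2) unfolding has_seq_henstock_integral_iff_fine_sum by blast
  obtain \<eta> where \<eta>: "\<And>n. gauge_fun_on p q (\<eta> n)"
      "\<And>s. (\<And>n. fine_sum (\<eta> n) f p q (s n)) \<Longrightarrow> s \<longlonglongrightarrow> B"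
    using assms(3) unfolding has_seq_henstock_integral_iff_fine_sum by blast
  have "gauge_fun_on p q (\<lambda>x. min (\<delta> n x) (\<eta> n x))" for n
    using \<delta>(1)[of n] \<eta>(1)[of n] by (simp add: gauge_fun_on_def)
  then have "\<exists>s. fine_sum (\<lambda>x. min (\<delta> n x) (\<eta> n x)) f p q s" for n
    by (rule fine_sum_exists[OF assms(1)])
  then obtain s where s: "\<And>n. fine_sum (\<lambda>x. min (\<delta> n x) (\<eta> n x)) f p q (s n)"
    by metis
  have "s \<longlonglongrightarrow> A"
    by (rule \<delta>(2), rule fine_sum_mono[OF s]) simp
  moreover have "s \<longlonglongrightarrow> B"
    by (rule \<eta>(2), rule fine_sum_mono[OF s]) simp
  ultimately show ?thesis
    by (rule LIMSEQ_unique)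
qed

lemma seq_henstock_integral_eqI:
  assumes "p \<le> q" and "has_seq_henstock_integral f p q A"
  shows "seq_henstock_integral f p q = A"
  unfolding seq_henstock_integral_def
  using assms has_seq_henstock_integral_unique by (intro the_equality) auto

lemma has_seq_henstock_integral_combine:
  assumes "a \<le> c" "c \<le> b"
    and "has_seq_henstock_integral f a c A" and "has_seq_henstock_integral f c b B"
  shows "has_seq_henstock_integral f a b (A + B)"
proof -
  obtain \<delta>\<^sub>1 where \<delta>\<^sub>1: "\<And>n. gauge_fun_on a c (\<delta>\<^sub>1 n)"
      "\<And>s. (\<And>n. fine_sum (\<delta>\<^sub>1 n) f a c (s n)) \<Longrightarrow> s \<longlonglongrightarrow> A"
    using assms(3) unfolding has_seq_henstock_integral_iff_fine_sum by blast
  obtain \<delta>\<^sub>2 where \<delta>\<^sub>2: "\<And>n. gauge_fun_on c b (\<delta>\<^sub>2 n)"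
      "\<And>s. (\<And>n. fine_sum (\<delta>\<^sub>2 n) f c b (s n)) \<Longrightarrow> s \<longlonglongrightarrow> B"
    using assms(4) unfolding has_seq_henstock_integral_iff_fine_sum by blast
  define \<delta> where "\<delta> n x =
      (if x < c then min (\<delta>\<^sub>1 n x) (c - x)
       else if x > c then min (\<delta>\<^sub>2 n x) (x - c)
       else min (\<delta>\<^sub>1 n x) (\<delta>\<^sub>2 n x))" for n x
  have "gauge_fun_on a b (\<delta> n)" for n
    using \<delta>\<^sub>1(1)[of n] \<delta>\<^sub>2(1)[of n] assms(1,2) by (auto simp: gauge_fun_on_def \<delta>_def)
  moreover have "s \<longlonglongrightarrow> A + B" if s: "\<forall>n. fine_sum (\<delta> n) f a b (s n)" for s
  proof -
    have "\<exists>s\<^sub>1 s\<^sub>2. fine_sum (\<delta> n) f a c s\<^sub>1 \<and> fine_sum (\<delta> n) f c b s\<^sub>2 \<and> s n = s\<^sub>1 + s\<^sub>2" for n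
      using s assms(1,2) by (intro fine_sum_split) (auto simp: \<delta>_def)
    then obtain s\<^sub>1 s\<^sub>2 where split: "\<And>n. fine_sum (\<delta> n) f a c (s\<^sub>1 n)"
        "\<And>n. fine_sum (\<delta> n) f c b (s\<^sub>2 n)" "\<And>n. s n = s\<^sub>1 n + s\<^sub>2 n"
      by metis
    have "s\<^sub>1 \<longlonglongrightarrow> A"
      by (rule \<delta>\<^sub>1(2), rule fine_sum_mono[OF split(1)]) (auto simp: \<delta>_def)
    moreover have "s\<^sub>2 \<longlonglongrightarrow> B"
      by (rule \<delta>\<^sub>2(2), rule fine_sum_mono[OF split(2)]) (auto simp: \<delta>_def)
    moreover have "s = (\<lambda>n. s\<^sub>1 n + s\<^sub>2 n)"
      using split(3) by blast
    ultimately show ?thesis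
      using tendsto_add by blast
  qed
  ultimately show ?thesis
    unfolding has_seq_henstock_integral_iff_fine_sum by blast
qed

theorem theorem6:
  fixes f :: "real \<Rightarrow> real" and a b c :: real
  assumes "c \<in> {a<..<b}"
    and "seq_henstock_integrable f a c"
    and "seq_henstock_integrable f c b"
  shows "seq_henstock_integrable f a b \<and>
    seq_henstock_integral f a b = seq_henstock_integral f a c + seq_henstock_integral f c b"
proof -
  have le: "a \<le> c" "c \<le> b" "a \<le> b"
    using assms(1) by auto
  obtain A B where A: "has_seq_henstock_integral f a c A" and B: "has_seq_henstock_integral f c b B"
    using assms(2,3) unfolding seq_henstock_integrable_def by blast
  have AB: "has_seq_henstock_integral f a b (A + B)"
    by (rule has_seq_henstock_integral_combine[OF le(1,2) A B])
  then have "seq_henstock_integrable f a b"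
    unfolding seq_henstock_integrable_def by blast
  moreover have "seq_henstock_integral f a b = A + B"
    by (rule seq_henstock_integral_eqI[OF le(3) AB])
  moreover have "seq_henstock_integral f a c = A"
    by (rule seq_henstock_integral_eqI[OF le(1) A])
  moreover have "seq_henstock_integral f c b = B"
    by (rule seq_henstock_integral_eqI[OF le(2) B])
  ultimately show ?thesis
    by simp
qed

end
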